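(* There exists an absolute constant $c>0$ such that for every integer $n\ge 1$ there exist $p,p',q,q'\in[0,1]^n$ such that $$\|p-q\|_2=\|p'-q'\|_2$$ (equivalently, the marginal total variation sequences of the pair $(\mathrm{Ber}(p),\mathrm{Ber}(q))$ and of the pair $(\mathrm{Ber}(p'),\mathrm{Ber}(q'))$ have the same $\ell_2$ norm, equal to this common value), while $$\frac{\|\mathrm{Ber}(p)-\mathrm{Ber}(q)\|_{\mathrm{TV}}}{\|\mathrm{Ber}(p')-\mathrm{Ber}(q')\|_{\mathrm{TV}}}\ \ge\ c\sqrt{n},$$ the ratio being well defined (nonzero denominator).
   Context: For two probability distributions $P,Q$ on a finite set $\Omega$, the total variation distance is $\|P-Q\|_{\mathrm{TV}}=\frac12\sum_{\omega\in\Omega}|P(\omega)-Q(\omega)|$. For $p\in[0,1]$, $\mathrm{Ber}(p)$ is the Bernoulli measure on $\{0,1\}$ with $\mathrm{Ber}(p)(1)=p$ and $\mathrm{Ber}(p)(0)=1-p$. For $p=(p_1,\ldots,p_n)\in[0,1]^n$, $\mathrm{Ber}(p)=\mathrm{Ber}(p_1)\otimes\cdots\otimes\mathrm{Ber}(p_n)$ is the product measure on $\{0,1\}^n$. The marginal total variation sequence of the pair $(\mathrm{Ber}(p),\mathrm{Ber}(q))$ is $(\|\mathrm{Ber}(p_i)-\mathrm{Ber}(q_i)\|_{\mathrm{TV}})_{i=1}^n=(|p_i-q_i|)_{i=1}^n$. For $x\in\mathbb{R}^n$, $\|x\|_2=(\sum_{i=1}^n x_i^2)^{1/2}$. *)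

theory Defs
  imports "HOL-Probability.Probability" "HOL-Probability.Product_PMF"
begin

(* Intended for finite Omega containing the supports of P and Q. *)
definition tv_dist :: "'a set \<Rightarrow> 'a pmf \<Rightarrow> 'a pmf \<Rightarrow> real" where
  "tv_dist \<Omega> P Q = (\<Sum>\<omega>\<in>\<Omega>. \<bar>pmf P \<omega> - pmf Q \<omega>\<bar>) / 2"

(* {0,1}^n as functions on {1..n}, with True for 1 and False for 0, extended by the
   dummy value False outside {1..n}; this is the carrier on which Pi_pmf lives. *)
definition cube :: "nat \<Rightarrow> (nat \<Rightarrow> bool) set" where
  "cube n = PiE_dflt {1..n} False (\<lambda>_. UNIV)"

(* Only the values p 1, ..., p n matter; they are meant to lie in [0,1]
   (bernoulli_pmf truncates parameters outside that interval). *)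
definition Ber :: "nat \<Rightarrow> (nat \<Rightarrow> real) \<Rightarrow> (nat \<Rightarrow> bool) pmf" where
  "Ber n p = Pi_pmf {1..n} False (\<lambda>i. bernoulli_pmf (p i))"

definition marginal_tv :: "(nat \<Rightarrow> real) \<Rightarrow> (nat \<Rightarrow> real) \<Rightarrow> nat \<Rightarrow> real" where
  "marginal_tv p q i = tv_dist UNIV (bernoulli_pmf (p i)) (bernoulli_pmf (q i))"

end

(* Spreading versus concentrating the same l2 mass 1 / sqrt n near the corner 0 of the cube:
   q = (1/n, ..., 1/n) leaves the point mass at 0 by a constant amount, since
   (1 - 1/n)^n \<le> exp (-1) \<le> 1/2, whereas q' = (1 / sqrt n, 0, ..., 0) is only at distance
   1 / sqrt n from it. *)
theory Submission
  imports Defs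
begin

text \<open>The outcomes True and False contribute equally, which cancels the factor 1/2. The range
  assumptions keep \<open>bernoulli_pmf\<close> from truncating its parameter.\<close>

lemma marginal_tv_eq:
  assumes "p i \<in> {0..1}" "q i \<in> {0..1}"
  shows "marginal_tv p q i = \<bar>p i - q i\<bar>"
  using assms by (auto simp: marginal_tv_def tv_dist_def UNIV_bool)

lemma L2_set_marginal_tv:
  assumes "p \<in> A \<rightarrow> {0..1}" "q \<in> A \<rightarrow> {0..1}"
  shows "L2_set (marginal_tv p q) A = L2_set (\<lambda>i. p i - q i) A"
proof -
  have "(marginal_tv p q i)\<^sup>2 = (p i - q i)\<^sup>2" if "i \<in> A" for i
    using assms that by (subst marginal_tv_eq) auto
  then show ?thesis
    by (simp add: L2_set_def)
qed

lemma finite_cube: "finite (cube n)"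
  unfolding cube_def by (intro finite_PiE_dflt) auto

lemma pmf_Ber:
  assumes "\<omega> \<in> cube n"
  shows "pmf (Ber n p) \<omega> = (\<Prod>i\<in>{1..n}. pmf (bernoulli_pmf (p i)) (\<omega> i))"
  using assms unfolding Ber_def cube_def PiE_dflt_def by (intro pmf_Pi') auto

lemma const_False_in_cube: "(\<lambda>_. False) \<in> cube n"
  by (auto simp: cube_def PiE_dflt_def)

lemma pmf_Ber_zero:
  assumes "\<omega> \<in> cube n"
  shows "pmf (Ber n (\<lambda>_. 0)) \<omega> = (if \<omega> = (\<lambda>_. False) then 1 else 0)"
proof (cases "\<omega> = (\<lambda>_. False)")
  case False
  then obtain i where "\<omega> i" by auto
  \<comment> \<open>Points of \<open>cube n\<close> are False outside \<open>{1..n}\<close>, so the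
    True coordinate is a genuine one and gives a vanishing factor in the product.\<close>
  then have "i \<in> {1..n}"
    using assms by (auto simp: cube_def PiE_dflt_def)
  with \<open>\<omega> i\<close> False show ?thesis
    by (auto simp: pmf_Ber[OF assms] intro!: prod_zero bexI[of _ i])
qed (use assms in \<open>simp add: pmf_Ber\<close>)

text \<open>One term of the sum suffices: at the all-False point the masses are 1 and at most 1/2,
  and the definition halves their gap.\<close>

lemma tv_dist_Ber_zero_const_ge:
  assumes "n \<ge> 1"
  shows "tv_dist (cube n) (Ber n (\<lambda>_. 0)) (Ber n (\<lambda>_. 1 / real n)) \<ge> 1 / 4"
proof -
  let ?P = "Ber n (\<lambda>_. 0)" and ?Q = "Ber n (\<lambda>_. 1 / real n)" and ?z = "\<lambda>_::nat. False"
  have "1 - 1 / real n \<le> exp (- (1 / real n))"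
    using exp_ge_add_one_self[of "- (1 / real n)"] by simp
  then have "(1 - 1 / real n) ^ n \<le> exp (- (1 / real n)) ^ n"
    using assms by (intro power_mono) auto
  also have "\<dots> = exp (- 1)"
    using assms by (simp flip: exp_of_nat_mult)
  \<comment> \<open>The bound 1 + x \<le> exp x at x = 1 gives exp 1 \<ge> 2.\<close>
  also have "\<dots> \<le> 1 / 2"
    using exp_ge_add_one_self[of 1] by (simp add: exp_minus field_simps)
  finally have "pmf ?Q ?z \<le> 1 / 2"
    using assms by (simp add: pmf_Ber const_False_in_cube)
  then have "1 / 2 \<le> \<bar>pmf ?P ?z - pmf ?Q ?z\<bar>"
    by (simp add: pmf_Ber_zero const_False_in_cube)
  also have "\<dots> \<le> (\<Sum>\<omega>\<in>cube n. \<bar>pmf ?P \<omega> - pmf ?Q \<omega>\<bar>)"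
    by (rule member_le_sum) (auto simp: const_False_in_cube finite_cube)
  finally show ?thesis
    by (simp add: tv_dist_def)
qed

text \<open>Both measures live on the two points \<open>?z\<close> and \<open>?e\<close>, so the sum
  has only two nontrivial terms. The exact value is what makes the ratio computable and, for a > 0,
  well defined.\<close>

lemma tv_dist_Ber_zero_single:
  assumes "j \<in> {1..n}" "a \<in> {0..1}"
  shows "tv_dist (cube n) (Ber n (\<lambda>_. 0)) (Ber n (\<lambda>i. if i = j then a else 0)) = a"
proof -
  let ?P = "Ber n (\<lambda>_. 0)" and ?Q = "Ber n (\<lambda>i. if i = j then a else 0)"
  let ?z = "\<lambda>_::nat. False" and ?e = "\<lambda>i. i = j"
  have e: "?e \<in> cube n"
    using assms by (auto simp: cube_def PiE_dflt_def)
  have ne: "?e \<noteq> ?z"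
    by (auto simp: fun_eq_iff)
  \<comment> \<open>Splitting off coordinate \<open>j\<close> leaves a product that vanishes as soon
    as another coordinate is True.\<close>
  have Q: "pmf ?Q \<omega> = pmf (bernoulli_pmf a) (\<omega> j) *
      (\<Prod>i\<in>{1..n} - {j}. pmf (bernoulli_pmf 0) (\<omega> i))" if "\<omega> \<in> cube n" for \<omega>
    unfolding pmf_Ber[OF that] using assms(1)
    by (subst prod.remove[of _ j]) (auto intro!: prod.cong)
  have Qz: "pmf ?Q ?z = 1 - a" and Qe: "pmf ?Q ?e = a"
    using assms(2) by (auto simp: Q const_False_in_cube e intro!: prod.neutral)
  have Q0: "pmf ?Q \<omega> = 0" if \<omega>: "\<omega> \<in> cube n" "\<omega> \<noteq> ?z" "\<omega> \<noteq> ?e" for \<omega>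
  proof -
    \<comment> \<open>A point whose True coordinates all equal \<open>j\<close> would be
      \<open>?z\<close> or \<open>?e\<close>.\<close>
    obtain i where i: "\<omega> i" "i \<noteq> j"
      using \<omega>(2,3) by (metis ext)
    then have "i \<in> {1..n} - {j}"
      using \<omega>(1) by (auto simp: cube_def PiE_dflt_def)
    with i have "(\<Prod>i\<in>{1..n} - {j}. pmf (bernoulli_pmf 0) (\<omega> i)) = 0"
      by (intro prod_zero bexI[of _ i]) auto
    then show ?thesis
      by (simp add: Q \<omega>(1))
  qed
  have "(\<Sum>\<omega>\<in>cube n. \<bar>pmf ?P \<omega> - pmf ?Q \<omega>\<bar>) = (\<Sum>\<omega>\<in>{?z, ?e}. \<bar>pmf ?P \<omega> - pmf ?Q \<omega>\<bar>)"
    using e by (intro sum.mono_neutral_right finite_cube)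
      (auto simp: const_False_in_cube pmf_Ber_zero Q0)
  \<comment> \<open>The terms are |1 - (1 - a)| at \<open>?z\<close> and |0 - a| at
    \<open>?e\<close>.\<close>
  also have "\<dots> = 2 * a"
    using ne assms(2) by (simp add: ne[symmetric] pmf_Ber_zero const_False_in_cube e Qz Qe)
  finally show ?thesis
    by (simp add: tv_dist_def)
qed

theorem theorem2:
  shows "\<exists>c::real. c > 0 \<and> (\<forall>n::nat. n \<ge> 1 \<longrightarrow>
    (\<exists>p p' q q' :: nat \<Rightarrow> real.
       p \<in> {1..n} \<rightarrow> {0..1} \<and> p' \<in> {1..n} \<rightarrow> {0..1} \<and>
       q \<in> {1..n} \<rightarrow> {0..1} \<and> q' \<in> {1..n} \<rightarrow> {0..1} \<and>
       L2_set (\<lambda>i. p i - q i) {1..n} = L2_set (\<lambda>i. p' i - q' i) {1..n} \<and>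
       L2_set (marginal_tv p q) {1..n} = L2_set (\<lambda>i. p i - q i) {1..n} \<and>
       L2_set (marginal_tv p' q') {1..n} = L2_set (\<lambda>i. p' i - q' i) {1..n} \<and>
       tv_dist (cube n) (Ber n p') (Ber n q') \<noteq> 0 \<and>
       tv_dist (cube n) (Ber n p) (Ber n q) / tv_dist (cube n) (Ber n p') (Ber n q')
         \<ge> c * sqrt (real n)))"
\<comment> \<open>The constant is the lower bound on the numerator; the factor sqrt n comes from the
  denominator.\<close>
proof (intro exI[of _ "1 / 4 :: real"] conjI allI impI)
  fix n :: nat
  assume n: "n \<ge> 1"
  \<comment> \<open>This choice gives a^2 = 1/n = n * (1/n)^2, matching the two l2 norms. Below,
    \<open>z\<close> serves as both \<open>p\<close> and \<open>p'\<close>.\<close>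
  define a where "a = 1 / sqrt (real n)"
  define z :: "nat \<Rightarrow> real" where "z = (\<lambda>_. 0)"
  define q :: "nat \<Rightarrow> real" where "q = (\<lambda>_. 1 / real n)"
  define q' :: "nat \<Rightarrow> real" where "q' = (\<lambda>i. if i = 1 then a else 0)"
  have a: "0 < a" "a \<le> 1"
    using n by (auto simp: a_def)
  have range: "z \<in> {1..n} \<rightarrow> {0..1}" "q \<in> {1..n} \<rightarrow> {0..1}" "q' \<in> {1..n} \<rightarrow> {0..1}"
    using n a by (auto simp: z_def q_def q'_def)
  have "(\<Sum>i\<in>{1..n}. (z i - q i)\<^sup>2) = 1 / real n"
    using n by (simp add: z_def q_def power2_eq_square)
  moreover have "(\<Sum>i\<in>{1..n}. (z i - q' i)\<^sup>2) = a\<^sup>2"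
  proof -
    have "(z i - q' i)\<^sup>2 = (if i = 1 then a\<^sup>2 else 0)" for i
      by (simp add: z_def q'_def)
    then show ?thesis
      using n by simp
  qed
  ultimately have L2: "L2_set (\<lambda>i. z i - q i) {1..n} = L2_set (\<lambda>i. z i - q' i) {1..n}"
    using n by (simp add: L2_set_def a_def power_divide)
  have tv: "tv_dist (cube n) (Ber n z) (Ber n q) \<ge> 1 / 4"
    using tv_dist_Ber_zero_const_ge[OF n] by (simp add: z_def q_def)
  have tv': "tv_dist (cube n) (Ber n z) (Ber n q') = a"
    using tv_dist_Ber_zero_single[of 1 n a] n a by (simp add: z_def q'_def)
  have "1 / 4 * sqrt (real n) \<le> tv_dist (cube n) (Ber n z) (Ber n q) * sqrt (real n)"
    using tv by (intro mult_right_mono) auto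
  \<comment> \<open>The denominator is exactly 1 / sqrt n, so dividing by it multiplies by sqrt
    n.\<close>
  also have "\<dots> = tv_dist (cube n) (Ber n z) (Ber n q) / tv_dist (cube n) (Ber n z) (Ber n q')"
    by (simp add: tv' a_def)
  finally show "\<exists>p p' q q' :: nat \<Rightarrow> real.
       p \<in> {1..n} \<rightarrow> {0..1} \<and> p' \<in> {1..n} \<rightarrow> {0..1} \<and>
       q \<in> {1..n} \<rightarrow> {0..1} \<and> q' \<in> {1..n} \<rightarrow> {0..1} \<and>
       L2_set (\<lambda>i. p i - q i) {1..n} = L2_set (\<lambda>i. p' i - q' i) {1..n} \<and>
       L2_set (marginal_tv p q) {1..n} = L2_set (\<lambda>i. p i - q i) {1..n} \<and>
       L2_set (marginal_tv p' q') {1..n} = L2_set (\<lambda>i. p' i - q' i) {1..n} \<and>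
       tv_dist (cube n) (Ber n p') (Ber n q') \<noteq> 0 \<and>
       tv_dist (cube n) (Ber n p) (Ber n q) / tv_dist (cube n) (Ber n p') (Ber n q')
         \<ge> 1 / 4 * sqrt (real n)"
    using range L2 tv' a
    by (intro exI[of _ z] exI[of _ q] exI[of _ q'] conjI L2_set_marginal_tv) auto
qed simp

end
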